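(* For every positive integer $m$, $$\mathrm{forb}(m,F(0,8,1,0))\le \Big\lfloor \tfrac{27}{5}m\Big\rfloor+1,$$ with equality when $m\equiv 0\pmod 5$.
   Context: A matrix is simple if it is a $(0,1)$-matrix with no repeated columns. For $(0,1)$-matrices $F,A$, $F$ is a configuration in $A$ (written $F\prec A$) if some submatrix of $A$ is a row and column permutation of $F$. $\mathrm{Avoid}(m,F)$ is the set of all simple $m$-rowed matrices $A$ with $F\not\prec A$, and $\mathrm{forb}(m,F)$ is the maximum number of columns of a matrix in $\mathrm{Avoid}(m,F)$. For $p\ge 1$, $F(0,p,1,0)$ is the $2\times(p+1)$ matrix whose first $p$ columns are $\binom{1}{0}$ and whose last column is $\binom{0}{1}$. *)

theory Defs
  imports
    "Jordan_Normal_Form.DL_Submatrix"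
    "HOL-Combinatorics.Permutations"
    "HOL-Number_Theory.Cong"
begin

definition simple_mat :: "nat mat \<Rightarrow> bool" where
  "simple_mat A \<longleftrightarrow> elements_mat A \<subseteq> {0, 1} \<and> distinct (cols A)"

definition row_col_perm :: "'a mat \<Rightarrow> 'a mat \<Rightarrow> bool" where
  "row_col_perm F B \<longleftrightarrow>
     (\<exists>p q. p permutes {..<dim_row F} \<and> q permutes {..<dim_col F} \<and>
            B = mat (dim_row F) (dim_col F) (\<lambda>(i, j). F $$ (p i, q j)))"

definition configuration :: "'a mat \<Rightarrow> 'a mat \<Rightarrow> bool" where
  "configuration F A \<longleftrightarrow> (\<exists>I J. row_col_perm F (submatrix A I J))"

definition Avoid :: "nat \<Rightarrow> nat mat \<Rightarrow> nat mat set" where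
  "Avoid m F = {A. dim_row A = m \<and> simple_mat A \<and> \<not> configuration F A}"

definition forb :: "nat \<Rightarrow> nat mat \<Rightarrow> nat" where
  "forb m F = Max (dim_col ` Avoid m F)"

(* Max is only meaningful on finite nonempty sets: the two lemmas below show
   that it is, as soon as F has at least one column. *)

lemma simple_mat_dim_col_le:
  assumes "simple_mat A"
  shows "dim_col A \<le> 2 ^ dim_row A"
proof -
  let ?f = "\<lambda>j. map (\<lambda>i. A $$ (i, j)) [0..<dim_row A]"
  let ?L = "{xs. set xs \<subseteq> {0, 1 :: nat} \<and> length xs = dim_row A}"
  have "j = k" if "j < dim_col A" "k < dim_col A" "?f j = ?f k" for j k
  proof -
    have "col A j = col A k"
      using that by (intro eq_vecI) (auto simp: list_eq_iff_nth_eq)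
    then have "cols A ! j = cols A ! k"
      using that by simp
    then show ?thesis
      using assms that nth_eq_iff_index_eq[of "cols A" j k] by (simp add: simple_mat_def)
  qed
  then have "inj_on ?f {..<dim_col A}"
    by (simp add: inj_on_def)
  moreover have "?f ` {..<dim_col A} \<subseteq> ?L"
  proof -
    have "A $$ (i, j) \<in> {0, 1}" if "i < dim_row A" "j < dim_col A" for i j
      using assms elements_matI[OF carrier_matI[OF refl refl] that refl]
      unfolding simple_mat_def by blast
    then show ?thesis
      by fastforce
  qed
  moreover have "finite ?L"
    by (rule finite_lists_length_eq) simp
  ultimately have "card {..<dim_col A} \<le> card ?L"
    by (rule card_inj_on_le)
  also have "card ?L = 2 ^ dim_row A"
    by (subst card_lists_length_eq) (simp_all add: numeral_2_eq_2)
  finally show ?thesis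
    by simp
qed

lemma finite_Avoid_dims: "finite (dim_col ` Avoid m F)"
  by (rule finite_subset[of _ "{..2 ^ m}"])
     (auto simp: Avoid_def dest: simple_mat_dim_col_le)

lemma Avoid_nonempty:
  assumes "0 < dim_col F"
  shows "Avoid m F \<noteq> {}"
proof -
  have "mat m 0 (\<lambda>_. 0) \<in> Avoid m F"
    using assms
    by (auto simp: Avoid_def simple_mat_def elements_mat_def cols_def configuration_def
        row_col_perm_def dest!: arg_cong[where f = dim_col] simp: dim_submatrix)
  then show ?thesis
    by blast
qed

definition F_0p10 :: "nat \<Rightarrow> nat mat" where
  "F_0p10 p = mat 2 (p + 1) (\<lambda>(i, j). if j < p then (if i = 0 then 1 else 0)
                                       else (if i = 0 then 0 else 1))"

end

theory Submission
  imports Defs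
begin

text \<open>
  Read the columns as subsets of the rows: for rows \<open>i\<close>, \<open>j\<close>, if some set contains \<open>j\<close> but not
  \<open>i\<close>, then at most 7 sets contain \<open>i\<close> but not \<open>j\<close>. Order the rows by decreasing degree, and call
  a set with \<open>i \<notin> S\<close>, \<open>j \<in> S\<close>, \<open>i < j\<close> an inversion of \<open>(i, j)\<close>. If no inversion crosses some cut
  of the rows, the family splits there and induction applies. Otherwise consecutive degrees differ
  by at most 6, since any inverted pair \<open>(i, j)\<close> has \<open>deg i - deg j \<le> 7 - 1\<close>.

  Let \<open>m \<ge> 6\<close> and let \<open>D\<close> be the difference of the extreme degrees. If \<open>D \<le> 14\<close>, every pair of rows is
  separated by at most 14 sets, and double counting \<open>\<Sum>S. |S| (m - |S|)\<close> suffices. If \<open>D \<ge> 15\<close>, there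
  are two bounds. Every set that is not a prefix inverts two consecutive rows, so
  \<open>|F| \<le> (m + 1) + 7 (m - 1) - D\<close>. On the other hand \<open>D\<close> sets contain the first row and not the last,
  none the converse, and each row is inverted with at most one of the two extreme rows, which gives
  \<open>|F| \<le> D + 2 + 4 (m - 2 - r)\<close> where the number \<open>r\<close> of rows of intermediate degree satisfies
  \<open>D \<le> 18 + 6 r\<close>. Together \<open>|F| \<le> 5 m + 3\<close>.

  For \<open>m \<le> 5\<close> only \<open>m = 5\<close> matters: three missing subsets cannot separate all ordered pairs of rows, but
  four can. Stacking copies of such a 28-element family attains the bound when 5 divides \<open>m\<close>.
\<close>

section \<open>Separation counts, degrees and relabelling of rows\<close>

definition sep :: "nat set set \<Rightarrow> nat \<Rightarrow> nat \<Rightarrow> nat set set" where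
  "sep F i j = {S \<in> F. i \<in> S \<and> j \<notin> S}"

definition family :: "nat \<Rightarrow> nat set set \<Rightarrow> bool" where
  "family m F \<longleftrightarrow> F \<subseteq> Pow {..<m} \<and>
     (\<forall>i<m. \<forall>j<m. sep F j i \<noteq> {} \<longrightarrow> card (sep F i j) \<le> 7)"

definition row_degree :: "nat set set \<Rightarrow> nat \<Rightarrow> nat" where
  "row_degree F i = card {S \<in> F. i \<in> S}"

text \<open>Preimage of a set of rows under \<open>h\<close>, cut to \<open>n\<close> rows. It
  serves both to sort the rows, with \<open>h\<close> a bijection, and to keep only the rows from a
  cut on, with \<open>h\<close> a shift.\<close>

definition pull :: "nat \<Rightarrow> (nat \<Rightarrow> nat) \<Rightarrow> nat set \<Rightarrow> nat set" where
  "pull n h S = {i. i < n \<and> h i \<in> S}"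

lemma family_finite: "family m F \<Longrightarrow> finite F"
  unfolding family_def by (meson finite_Pow_iff finite_lessThan finite_subset)

lemma finite_sep: "finite F \<Longrightarrow> finite (sep F i j)"
  by (simp add: sep_def)

text \<open>Both sides count the sets that contain \<open>i\<close> or \<open>j\<close>. So a
  difference of degrees is a difference of separation counts; this turns the bound 7 into 6 as soon
  as the opposite count is at least 1.\<close>

lemma row_degree_add_sep:
  assumes "finite F"
  shows "row_degree F i + card (sep F j i) = row_degree F j + card (sep F i j)"
proof -
  have "{S \<in> F. i \<in> S} \<union> sep F j i = {S \<in> F. j \<in> S} \<union> sep F i j"
    by (auto simp: sep_def)
  moreover have "card ({S \<in> F. i \<in> S} \<union> sep F j i) = row_degree F i + card (sep F j i)"
    unfolding row_degree_def using assms by (intro card_Un_disjoint) (auto simp: sep_def)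
  moreover have "card ({S \<in> F. j \<in> S} \<union> sep F i j) = row_degree F j + card (sep F i j)"
    unfolding row_degree_def using assms by (intro card_Un_disjoint) (auto simp: sep_def)
  ultimately show ?thesis by simp
qed

lemma card_sep_pull:
  assumes "inj_on (pull n h) F" "i < n" "j < n"
  shows "card (sep (pull n h ` F) i j) = card (sep F (h i) (h j))"
proof -
  have "sep (pull n h ` F) i j = pull n h ` sep F (h i) (h j)"
    using assms(2,3) by (auto simp: sep_def pull_def)
  moreover have "inj_on (pull n h) (sep F (h i) (h j))"
    using assms(1) by (rule inj_on_subset) (auto simp: sep_def)
  ultimately show ?thesis by (simp add: card_image)
qed

lemma row_degree_pull:
  assumes "inj_on (pull n h) F" "i < n"
  shows "row_degree (pull n h ` F) i = row_degree F (h i)"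
proof -
  have "{S \<in> pull n h ` F. i \<in> S} = pull n h ` {S \<in> F. h i \<in> S}"
    using assms(2) by (auto simp: pull_def)
  moreover have "inj_on (pull n h) {S \<in> F. h i \<in> S}"
    using assms(1) by (rule inj_on_subset) auto
  ultimately show ?thesis by (simp add: row_degree_def card_image)
qed

text \<open>In this form the condition sees \<open>sep\<close> only through cardinalities, which
  \<open>card_sep_pull\<close> transports.\<close>

lemma family_iff_card:
  "family m F \<longleftrightarrow> F \<subseteq> Pow {..<m} \<and>
     (\<forall>i<m. \<forall>j<m. card (sep F j i) > 0 \<longrightarrow> card (sep F i j) \<le> 7)"
proof (cases "F \<subseteq> Pow {..<m}")
  case True
  then have "finite F" by (meson finite_Pow_iff finite_lessThan finite_subset)
  then have "card (sep F j i) > 0 \<longleftrightarrow> sep F j i \<noteq> {}" for i j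
    by (simp add: card_gt_0_iff finite_sep)
  then show ?thesis by (simp add: family_def)
qed (simp add: family_def)

lemma family_pull:
  assumes "family m F" "inj_on (pull n h) F" "h ` {..<n} \<subseteq> {..<m}"
  shows "family n (pull n h ` F)"
  unfolding family_iff_card
proof (intro conjI allI impI)
  show "pull n h ` F \<subseteq> Pow {..<n}" by (auto simp: pull_def)
  fix i j assume ij: "i < n" "j < n" "0 < card (sep (pull n h ` F) j i)"
  then have "h i < m" "h j < m" using assms(3) by auto
  then show "card (sep (pull n h ` F) i j) \<le> 7"
    using assms(1) ij by (simp add: family_iff_card card_sep_pull[OF assms(2)])
qed

lemma family_subset:
  assumes "family m F" "G \<subseteq> F"
  shows "family m G"
proof -
  have "card (sep G i j) \<le> card (sep F i j)" for i j
    using family_finite[OF assms(1)] assms(2)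
    by (intro card_mono finite_sep) (auto simp: sep_def)
  then show ?thesis
    using assms unfolding family_iff_card
    by (metis (no_types, lifting) order.strict_trans2 order_trans)
qed

lemma sort_family:
  assumes "family m F"
  obtains G where "family m G" "card G = card F"
    "\<And>i j. i \<le> j \<Longrightarrow> j < m \<Longrightarrow> row_degree G j \<le> row_degree G i"
proof -
  define xs where "xs = rev (sort_key (row_degree F) [0..<m])"
  define h where "h i = xs ! i" for i
  have len: "length xs = m" and set: "set xs = {..<m}" and dist: "distinct xs"
    by (auto simp: xs_def)
  have sorted: "sorted_wrt (\<lambda>x y. row_degree F y \<le> row_degree F x) xs"
    unfolding xs_def sorted_wrt_rev using sorted_sort_key[of "row_degree F" "[0..<m]"]
    by (simp add: sorted_map)
  have img: "h ` {..<m} = {..<m}"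
    using set len unfolding h_def set_conv_nth by auto
  have inj: "inj_on (pull m h) F"
  proof (rule inj_onI)
    fix S T assume ST: "S \<in> F" "T \<in> F" "pull m h S = pull m h T"
    \<comment> \<open>Since \<open>h\<close> maps onto \<open>{..<m}\<close>, a set is the image of
      its pullback, so no two sets are merged.\<close>
    have rec: "U = h ` pull m h U" if "U \<in> F" for U
    proof -
      have "U \<subseteq> h ` {..<m}" using that assms img by (auto simp: family_def)
      then show ?thesis by (auto simp: pull_def)
    qed
    show "S = T" using rec[OF ST(1)] rec[OF ST(2)] ST(3) by simp
  qed
  show ?thesis
  proof
    show "family m (pull m h ` F)" using family_pull[OF assms inj] img by simp
    show "card (pull m h ` F) = card F" by (rule card_image[OF inj])
    show "row_degree (pull m h ` F) j \<le> row_degree (pull m h ` F) i" if "i \<le> j" "j < m" for i j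
    proof (cases "i = j")
      case False
      then have "row_degree F (h j) \<le> row_degree F (h i)"
        using sorted that len unfolding h_def sorted_wrt_iff_nth_less by auto
      then show ?thesis using that by (simp add: row_degree_pull[OF inj])
    qed simp
  qed
qed

section \<open>Families on at most five rows\<close>

lemma card_sep_Pow:
  assumes "finite V" "i \<in> V" "j \<in> V" "i \<noteq> j"
  shows "card (sep (Pow V) i j) = 2 ^ (card V - 2)"
proof -
  have "sep (Pow V) i j = insert i ` Pow (V - {i, j})"
  proof (intro equalityI subsetI)
    fix S assume "S \<in> sep (Pow V) i j"
    then have "S = insert i (S - {i})" "S - {i} \<in> Pow (V - {i, j})" by (auto simp: sep_def)
    then show "S \<in> insert i ` Pow (V - {i, j})" by blast
  qed (use assms in \<open>auto simp: sep_def\<close>)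
  moreover have "inj_on (insert i) (Pow (V - {i, j}))"
    by (auto simp: inj_on_def)
  moreover have "card (V - {i, j}) = card V - 2"
    using assms by (simp add: card_Diff_subset)
  ultimately show ?thesis using assms(1) by (simp add: card_image card_Pow)
qed

text \<open>Read \<open>x\<close>, \<open>y\<close>, \<open>z\<close> as three sets on four points.
  Recording for each point which of them contain it would give an antichain of size 4 among the
  subsets of a 3-element set, against Sperner's bound 3. The twelve instances are propositionally
  inconsistent.\<close>

lemma no_antichain_4_of_3:
  fixes x y z :: "nat \<Rightarrow> bool"
  assumes "\<And>i j. i < 4 \<Longrightarrow> j < 4 \<Longrightarrow> i \<noteq> j \<Longrightarrow> (x i \<and> \<not> x j) \<or> (y i \<and> \<not> y j) \<or> (z i \<and> \<not> z j)"
  shows False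
proof -
  note * = assms[of 0 1, simplified]
    assms[of 0 2, simplified]
    assms[of 0 3, simplified]
    assms[of 1 0, simplified]
    assms[of 1 2, simplified]
    assms[of 1 3, simplified]
    assms[of 2 0, simplified]
    assms[of 2 1, simplified]
    assms[of 2 3, simplified]
    assms[of 3 0, simplified]
    assms[of 3 1, simplified]
    assms[of 3 2, simplified]
  from * show False by satx
qed

text \<open>Each ordered pair of distinct rows is separated by 8 of the 32 subsets, so some omitted
  set must separate it; otherwise all 8 sets separating the reversed pair are omitted. With at most
  three omitted sets, four of the rows already contradict
  \<open>no_antichain_4_of_3\<close>.\<close>

lemma card_family_5:
  assumes "family 5 F"
  shows "card F \<le> 28"
proof (rule ccontr)
  assume "\<not> card F \<le> 28"
  define R where "R = Pow {..<5::nat} - F"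
  have FP: "F \<subseteq> Pow {..<5}" using assms by (simp add: family_def)
  have finR: "finite R" by (simp add: R_def)
  have "card R = 32 - card F"
    using FP family_finite[OF assms] by (simp add: R_def card_Diff_subset card_Pow)
  then have R3: "card R \<le> 3" using \<open>\<not> card F \<le> 28\<close> by simp
  then obtain X Y Z where XYZ: "R \<subseteq> {X, Y, Z}"
  proof -
    obtain xs where xs: "set xs = R" "distinct xs" using finite_distinct_list[OF finR] by blast
    then have "length xs \<le> 3" using R3 distinct_card[of xs] by simp
    \<comment> \<open>Positions past the end of \<open>xs\<close> have unspecified values, which can
      only enlarge the right-hand side.\<close>
    have "R \<subseteq> {xs ! 0, xs ! 1, xs ! 2}"
    proof
      fix S assume "S \<in> R"
      then obtain i where i: "i < length xs" "S = xs ! i"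
        unfolding xs(1)[symmetric] in_set_conv_nth by blast
      then consider "i = 0" | "i = 1" | "i = 2" using \<open>length xs \<le> 3\<close> by linarith
      then show "S \<in> {xs ! 0, xs ! 1, xs ! 2}" using i(2) by cases simp_all
    qed
    then show ?thesis by (rule that)
  qed
  have missing: "\<exists>S\<in>R. i \<in> S \<and> j \<notin> S" if ij: "i < 5" "j < 5" "i \<noteq> j" for i j
  proof (rule ccontr)
    assume none: "\<not> ?thesis"
    have all: "card (sep (Pow {..<5}) k l) = 8" if "k < 5" "l < 5" "k \<noteq> l" for k l
      using that card_sep_Pow[of "{..<5}" k l] by simp
    have "sep F i j = sep (Pow {..<5}) i j"
      using none FP by (auto simp: sep_def R_def)
    then have "card (sep F i j) = 8" using all[of i j] ij by simp
    then have "\<not> card (sep F i j) \<le> 7" by simp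
    then have "sep F j i = {}" using assms ij unfolding family_def by blast
    then have "sep (Pow {..<5}) j i \<subseteq> R" by (auto simp: sep_def R_def)
    then have "card (sep (Pow {..<5}) j i) \<le> card R" by (rule card_mono[OF finR])
    moreover have "card (sep (Pow {..<5}) j i) = 8" using ij by (intro all) auto
    ultimately show False using R3 by linarith
  qed
  show False
  proof (rule no_antichain_4_of_3)
    fix i j :: nat assume "i < 4" "j < 4" "i \<noteq> j"
    then obtain S where "S \<in> R" "i \<in> S" "j \<notin> S" using missing[of i j] by auto
    moreover from this XYZ have "S = X \<or> S = Y \<or> S = Z" by blast
    ultimately show "(i \<in> X \<and> \<not> j \<in> X) \<or> (i \<in> Y \<and> \<not> j \<in> Y) \<or> (i \<in> Z \<and> \<not> j \<in> Z)"
      by blast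
  qed
qed

text \<open>There is no slack at \<open>m = 0\<close> (5 = 5) and \<open>m = 5\<close> (140 = 140).
  Up to \<open>m = 4\<close> the number \<open>2 ^ m\<close> of all subsets is small enough.\<close>

lemma card_family_small:
  assumes "family m F" "m \<le> 5"
  shows "5 * card F \<le> 27 * m + 5"
proof (cases "m = 5")
  case True
  then show ?thesis using card_family_5[of F] assms(1) by simp
next
  case False
  have "card F \<le> card (Pow {..<m})"
    using assms(1) by (intro card_mono) (auto simp: family_def)
  then have bound: "card F \<le> 2 ^ m" by (simp add: card_Pow)
  have "m \<in> {0, 1, 2, 3, 4}" using False assms(2) by (auto simp: numeral_eq_Suc le_Suc_eq)
  then have "5 * 2 ^ m \<le> 27 * m + 5" by auto
  then show ?thesis using bound by linarith
qed

section \<open>Double counting, and families with nearly equal degrees\<close>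

lemma sum_card_eq_sum_count:
  assumes "finite H" "finite Q" "H \<subseteq> Pow Q"
  shows "(\<Sum>S\<in>H. card S) = (\<Sum>i\<in>Q. card {S \<in> H. i \<in> S})"
proof -
  have "card S = card {i \<in> Q. i \<in> S}" if "S \<in> H" for S
    using that assms(3) by (intro arg_cong[where f = card]) auto
  then have "(\<Sum>S\<in>H. card S) = (\<Sum>S\<in>H. card {i \<in> Q. i \<in> S})" by (rule sum.cong[OF refl])
  also have "\<dots> = (\<Sum>i\<in>Q. card {S \<in> H. i \<in> S})"
    using assms(1,2) by (intro sum_multicount_gen ballI refl)
  finally show ?thesis .
qed

text \<open>The sizes of the sets sum to at most \<open>7 * card Q\<close>. Every set has size at
  least 2, except at most \<open>card Q\<close> singletons that fall short by 1; hence
  \<open>2 * card H \<le> 8 * card Q\<close>.\<close>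

lemma card_bounded_degree:
  assumes "finite Q" "H \<subseteq> Pow Q" "{} \<notin> H"
    and deg: "\<And>i. i \<in> Q \<Longrightarrow> card {S \<in> H. i \<in> S} \<le> 7"
  shows "card H \<le> 4 * card Q"
proof -
  have finH: "finite H" using assms(1,2) by (meson finite_Pow_iff finite_subset)
  let ?H1 = "{S \<in> H. card S = 1}"
  have "?H1 \<subseteq> (\<lambda>i. {i}) ` Q"
    using assms(2) by (auto simp: card_1_singleton_iff)
  then have H1: "card ?H1 \<le> card Q"
    using assms(1) by (rule surj_card_le[rotated])
  have "2 * card H = (\<Sum>S\<in>H. 2)" by simp
  also have "\<dots> \<le> (\<Sum>S\<in>H. card S + (if card S = 1 then 1 else 0))"
  proof (rule sum_mono)
    fix S assume "S \<in> H"
    then have "S \<subseteq> Q" "S \<noteq> {}" using assms(2,3) by auto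
    then have "card S \<noteq> 0" using finite_subset[OF _ assms(1)] by simp
    then show "2 \<le> card S + (if card S = 1 then 1 else 0)" by simp
  qed
  also have "\<dots> = (\<Sum>S\<in>H. card S) + card ?H1"
    using finH by (simp add: sum.distrib sum.If_cases Int_def)
  also have "(\<Sum>S\<in>H. card S) = (\<Sum>i\<in>Q. card {S \<in> H. i \<in> S})"
    using finH assms by (intro sum_card_eq_sum_count)
  also have "\<dots> \<le> (\<Sum>i\<in>Q. 7)" by (rule sum_mono) (rule deg)
  finally show ?thesis using H1 by simp
qed

text \<open>Both sides count triples of a set, a row inside it and a row outside it.\<close>

lemma sum_card_sep:
  assumes "F \<subseteq> Pow {..<m}"
  shows "(\<Sum>i<m. \<Sum>j<m. card (sep F i j)) = (\<Sum>S\<in>F. card S * (m - card S))"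
proof -
  have finF: "finite F" using assms by (meson finite_Pow_iff finite_lessThan finite_subset)
  have "(\<Sum>i<m. \<Sum>j<m. card (sep F i j)) = (\<Sum>(i, j)\<in>{..<m} \<times> {..<m}. card (sep F i j))"
    by (simp add: sum.cartesian_product)
  also have "\<dots> = (\<Sum>x\<in>{..<m} \<times> {..<m}. card {S \<in> F. fst x \<in> S \<and> snd x \<notin> S})"
    by (simp add: sep_def split_def)
  also have "\<dots> = (\<Sum>S\<in>F. card {x \<in> {..<m} \<times> {..<m}. fst x \<in> S \<and> snd x \<notin> S})"
    using finF by (intro sum_multicount_gen ballI refl) auto
  also have "\<dots> = (\<Sum>S\<in>F. card S * (m - card S))"
  proof (rule sum.cong)
    fix S assume "S \<in> F"
    then have S: "S \<subseteq> {..<m}" using assms by auto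
    then have "{x \<in> {..<m} \<times> {..<m}. fst x \<in> S \<and> snd x \<notin> S} = S \<times> ({..<m} - S)" by auto
    then show "card {x \<in> {..<m} \<times> {..<m}. fst x \<in> S \<and> snd x \<notin> S} = card S * (m - card S)"
      using S by (simp add: card_cartesian_product card_Diff_subset finite_subset[OF S])
  qed simp
  finally show ?thesis .
qed

text \<open>With \<open>s = 2 + a\<close> and \<open>m - s = 2 + b\<close>, the two sides differ by
  \<open>a * b\<close>.\<close>

lemma prod_ge_2_times:
  fixes s m :: nat
  assumes "2 \<le> s" "s + 2 \<le> m"
  shows "2 * (m - 2) \<le> s * (m - s)"
proof -
  obtain a where a: "s = 2 + a" using assms(1) le_Suc_ex by blast
  obtain b where b: "m = s + 2 + b" using assms(2) le_Suc_ex by blast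
  show ?thesis by (simp add: a b algebra_simps)
qed

text \<open>Summing \<open>sym\<close> over pairs bounds the total of
  \<open>card S * (m - card S)\<close> by \<open>7 * (m * (m - 1))\<close>. A set of size between 2
  and \<open>m - 2\<close> contributes at least \<open>2 * (m - 2)\<close>, and there are at most
  \<open>2 * m + 2\<close> other sets.\<close>

lemma card_family_flat:
  assumes F: "F \<subseteq> Pow {..<m}" and m: "6 \<le> m"
    and sym: "\<And>i j. i < m \<Longrightarrow> j < m \<Longrightarrow> card (sep F i j) + card (sep F j i) \<le> 14"
  shows "5 * card F \<le> 27 * m + 5"
proof -
  have finF: "finite F" using F by (meson finite_Pow_iff finite_lessThan finite_subset)
  define cost where "cost S = card S * (m - card S)" for S :: "nat set"
  define F0 where "F0 = {S \<in> F. card S = 0 \<or> card S = m}"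
  define F1 where "F1 = {S \<in> F. card S = 1 \<or> card S = m - 1}"
  have finS: "finite S" "card S \<le> m" "S \<subseteq> {..<m}" if "S \<in> F" for S
  proof -
    show "S \<subseteq> {..<m}" using that F by blast
    then show "finite S" "card S \<le> m"
      using finite_subset[of S "{..<m}"] card_mono[of "{..<m}" S] by auto
  qed
  have "F0 \<subseteq> {{}, {..<m}}"
  proof
    fix S assume "S \<in> F0"
    then have S: "S \<in> F" "card S = 0 \<or> card S = m" by (auto simp: F0_def)
    then show "S \<in> {{}, {..<m}}"
      using finS[OF S(1)] card_subset_eq[of "{..<m}" S] by auto
  qed
  then have c0: "card F0 \<le> 2"
    using card_mono[of "{{}, {..<m}}" F0] by (simp add: card_insert_if split: if_splits)
  have "F1 \<subseteq> (\<lambda>i. {i}) ` {..<m} \<union> (\<lambda>i. {..<m} - {i}) ` {..<m}"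
  proof
    fix S assume S: "S \<in> F1"
    then have SF: "S \<in> F" by (simp add: F1_def)
    show "S \<in> (\<lambda>i. {i}) ` {..<m} \<union> (\<lambda>i. {..<m} - {i}) ` {..<m}"
    proof (cases "card S = 1")
      case True
      then show ?thesis using finS[OF SF] by (auto simp: card_1_singleton_iff)
    next
      case False
      then have "card ({..<m} - S) = 1"
        using S m finS[OF SF] by (simp add: F1_def card_Diff_subset)
      then obtain i where "{..<m} - S = {i}" by (auto simp: card_1_singleton_iff)
      then have "S = {..<m} - {i}" "i < m" using finS[OF SF] by auto
      then show ?thesis by blast
    qed
  qed
  then have "card F1 \<le> card ((\<lambda>i. {i}) ` {..<m} \<union> (\<lambda>i. {..<m} - {i}) ` {..<m})"
    by (intro card_mono) auto
  also have "\<dots> \<le> card ((\<lambda>i. {i}) ` {..<m}) + card ((\<lambda>i. {..<m} - {i}) ` {..<m})"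
    by (rule card_Un_le)
  also have "\<dots> \<le> m + m"
    by (intro add_mono card_image_le[of "{..<m}", simplified])
  finally have c1: "card F1 \<le> 2 * m" by simp
  have "2 * (\<Sum>S\<in>F. cost S) = (\<Sum>i<m. \<Sum>j<m. card (sep F i j)) + (\<Sum>j<m. \<Sum>i<m. card (sep F i j))"
    using sum_card_sep[OF F] sum.swap[of "\<lambda>i j. card (sep F i j)" "{..<m}" "{..<m}"]
    by (simp add: cost_def)
  also have "\<dots> = (\<Sum>i<m. \<Sum>j<m. card (sep F i j) + card (sep F j i))"
    by (simp add: sum.distrib)
  \<comment> \<open>No set separates a row from itself, so the diagonal costs nothing.\<close>
  also have "\<dots> \<le> (\<Sum>i<m. \<Sum>j<m. if j = i then 0 else 14)"
    using sym by (intro sum_mono) (auto simp: sep_def)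
  also have "\<dots> = (\<Sum>i<m. 14 * (m - 1))"
  proof (rule sum.cong)
    fix i assume "i \<in> {..<m}"
    then have "(\<Sum>j<m. if j = i then 0 else 14) = (\<Sum>j\<in>{..<m} - {i}. 14::nat)"
      by (intro sum.mono_neutral_cong_right) auto
    then show "(\<Sum>j<m. if j = i then 0 else 14) = 14 * (m - 1)" using \<open>i \<in> {..<m}\<close> by simp
  qed simp
  finally have cost: "(\<Sum>S\<in>F. cost S) \<le> 7 * (m * (m - 1))" by simp
  have "2 * (m - 2) * card F = (\<Sum>S\<in>F. 2 * (m - 2))" by simp
  \<comment> \<open>The extra terms make up the deficits: a set of size 1 or \<open>m - 1\<close>
    costs \<open>m - 1\<close>, which is \<open>m - 3\<close> too little, and the empty and the full
    set cost 0.\<close>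
  also have "\<dots> \<le> (\<Sum>S\<in>F. cost S + (if S \<in> F1 then m - 3 else 0) + (if S \<in> F0 then 2 * (m - 2) else 0))"
  proof (rule sum_mono)
    fix S assume S: "S \<in> F"
    consider "S \<in> F0" | "S \<in> F1" | "2 \<le> card S" "card S + 2 \<le> m"
      using S finS(2)[OF S] by (auto simp: F0_def F1_def) linarith
    then show "2 * (m - 2) \<le> cost S + (if S \<in> F1 then m - 3 else 0) + (if S \<in> F0 then 2 * (m - 2) else 0)"
    proof cases
      case 2
      then have "cost S = m - 1" using m by (auto simp: F1_def cost_def)
      then show ?thesis using 2 m by simp
    next
      case 3
      then show ?thesis using prod_ge_2_times unfolding cost_def by (simp add: trans_le_add1)
    qed simp
  qed
  also have "\<dots> = (\<Sum>S\<in>F. cost S) + (m - 3) * card F1 + 2 * (m - 2) * card F0"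
  proof -
    have "F \<inter> F1 = F1" "F \<inter> F0 = F0" by (auto simp: F0_def F1_def)
    then show ?thesis using finF by (simp add: sum.distrib sum.If_cases)
  qed
  also have "\<dots> \<le> 7 * (m * (m - 1)) + (m - 3) * (2 * m) + 2 * (m - 2) * 2"
    using cost c0 c1 by (intro add_mono mult_left_mono) auto
  finally have main: "2 * (m - 2) * card F \<le> 7 * (m * (m - 1)) + (m - 3) * (2 * m) + 2 * (m - 2) * 2" .
  show ?thesis
  proof (rule ccontr)
    \<comment> \<open>The two sides compared below differ by \<open>9 * m^2 - 51 * m + 16\<close>,
      which is negative at 5 but equals \<open>9 * t^2 + 57 * t + 34\<close> for
      \<open>m = 6 + t\<close>.\<close>
    obtain t where t: "m = 6 + t" using m le_Suc_ex by blast
    assume "\<not> ?thesis"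
    then have "27 * m + 6 \<le> 5 * card F" by simp
    then have "2 * (m - 2) * (27 * m + 6) \<le> 2 * (m - 2) * (5 * card F)" by (rule mult_left_mono) simp
    also have "\<dots> = 5 * (2 * (m - 2) * card F)" by simp
    also have "\<dots> \<le> 5 * (7 * (m * (m - 1)) + (m - 3) * (2 * m) + 2 * (m - 2) * 2)"
      using main by (rule mult_left_mono) simp
    finally show False by (simp add: t algebra_simps)
  qed
qed

section \<open>Families with a large spread of degrees\<close>

lemma card_family_steep:
  assumes fam: "family m F" and m: "6 \<le> m"
    and sorted: "\<And>i j. i \<le> j \<Longrightarrow> j < m \<Longrightarrow> row_degree F j \<le> row_degree F i"
    and gap: "\<And>i. Suc i < m \<Longrightarrow> row_degree F i \<le> row_degree F (Suc i) + 6"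
    and steep: "row_degree F (m - 1) + 15 \<le> row_degree F 0"
  shows "5 * card F \<le> 27 * m + 5"
proof -
  define a where "a = row_degree F"
  define l where "l = m - 1"
  define D where "D = a 0 - a l"
  have finF: "finite F" and F: "F \<subseteq> Pow {..<m}" using fam family_finite by (auto simp: family_def)
  have l: "l < m" "0 < l" "m = Suc l" using m by (auto simp: l_def)
  have aD: "a 0 = a l + D" "15 \<le> D" using steep by (auto simp: D_def a_def l_def)
  have close: "a i \<le> a j + 6" if "sep F j i \<noteq> {}" "i < m" "j < m" for i j
  proof -
    have "card (sep F i j) \<le> 7" using fam that by (auto simp: family_def)
    moreover have "1 \<le> card (sep F j i)" using that finite_sep[OF finF] by (simp add: Suc_le_eq card_gt_0_iff)
    ultimately show ?thesis using row_degree_add_sep[OF finF, of i j] by (simp add: a_def)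
  qed
  \<comment> \<open>Without a set that separates \<open>i\<close> from \<open>j\<close>, the order
    of the degrees forces \<open>sep F j i\<close> to be empty too; with one, the defining condition
    of a family applies.\<close>
  have inv7: "card (sep F j i) \<le> 7" if "i < j" "j < m" for i j
  proof (cases "sep F i j = {}")
    case True
    then have "card (sep F j i) = 0"
      using row_degree_add_sep[OF finF, of i j] sorted[of i j] that by simp
    then show ?thesis by simp
  next
    case False
    then show ?thesis using fam that by (simp add: family_def)
  qed
  \<comment> \<open>\<open>Q1\<close> and \<open>Q2\<close> hold the rows inverted with the first
    and with the last row. The rows of \<open>R\<close> are, by \<open>close\<close>, too far in
    degree from both extreme rows to be inverted with either.\<close>
  define Q1 where "Q1 = {i. i < m \<and> sep F i 0 \<noteq> {}}"
  define Q2 where "Q2 = {i. i < m \<and> sep F l i \<noteq> {}}"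
  define R where "R = {i. i < m \<and> a l + 7 \<le> a i \<and> a i + 7 \<le> a 0}"
  have no_l0: "sep F l 0 = {}" using close[of l 0] aD l by auto
  define N1 where "N1 = {S \<in> F. 0 \<notin> S \<and> l \<notin> S \<and> S \<noteq> {}}"
  define N2 where "N2 = {S \<in> F. 0 \<in> S \<and> l \<in> S \<and> S \<noteq> {..<m}}"
  \<comment> \<open>A set in \<open>N1\<close> misses row 0, so all its elements lie in
    \<open>Q1\<close>, and \<open>inv7\<close> bounds how often each of them occurs. For
    \<open>N2\<close> the same argument is applied to complements and the last row.\<close>
  have cN1: "card N1 \<le> 4 * card Q1"
  proof (rule card_bounded_degree)
    show "N1 \<subseteq> Pow Q1" using F by (auto simp: N1_def Q1_def sep_def)
    fix i assume i: "i \<in> Q1"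
    then have "0 < i" by (auto simp: Q1_def sep_def intro: Nat.gr0I)
    have "card {S \<in> N1. i \<in> S} \<le> card (sep F i 0)"
      by (rule card_mono[OF finite_sep[OF finF]]) (auto simp: N1_def sep_def)
    also have "\<dots> \<le> 7" using inv7 \<open>0 < i\<close> i by (simp add: Q1_def)
    finally show "card {S \<in> N1. i \<in> S} \<le> 7" .
  qed (auto simp: N1_def Q1_def)
  have cN2: "card N2 \<le> 4 * card Q2"
  proof -
    have inj: "inj_on (\<lambda>S. {..<m} - S) N2"
    proof (rule inj_onI)
      fix S T assume "S \<in> N2" "T \<in> N2" "{..<m} - S = {..<m} - T"
      moreover from this have "S \<subseteq> {..<m}" "T \<subseteq> {..<m}" using F by (auto simp: N2_def)
      ultimately show "S = T" by blast
    qed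
    have "card ((\<lambda>S. {..<m} - S) ` N2) \<le> 4 * card Q2"
    proof (rule card_bounded_degree)
      show "(\<lambda>S. {..<m} - S) ` N2 \<subseteq> Pow Q2" using F by (auto simp: N2_def Q2_def sep_def)
      show "{} \<notin> (\<lambda>S. {..<m} - S) ` N2" using F by (auto simp: N2_def)
      fix i assume i: "i \<in> Q2"
      then have il: "i < l" using l by (auto simp: Q2_def sep_def less_Suc_eq)
      have "card {S \<in> (\<lambda>S. {..<m} - S) ` N2. i \<in> S} \<le> card ((\<lambda>S. {..<m} - S) ` sep F l i)"
        by (rule card_mono[OF finite_imageI[OF finite_sep[OF finF]]]) (auto simp: N2_def sep_def)
      also have "\<dots> \<le> card (sep F l i)" by (rule card_image_le[OF finite_sep[OF finF]])
      also have "\<dots> \<le> 7" using inv7 il l by simp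
      finally show "card {S \<in> (\<lambda>S. {..<m} - S) ` N2. i \<in> S} \<le> 7" .
    qed (simp add: Q2_def)
    then show ?thesis by (simp add: card_image[OF inj])
  qed
  have cQ: "card Q1 + card Q2 + card R \<le> m - 2"
  proof -
    have d1: "a 0 \<le> a i + 6" if "i \<in> Q1" for i using that close[of i 0] l by (simp add: Q1_def)
    have d2: "a i \<le> a l + 6" if "i \<in> Q2" for i using that close[of l i] l by (simp add: Q2_def)
    \<comment> \<open>A common row would give \<open>D \<le> 12\<close>.\<close>
    have "Q1 \<inter> Q2 = {}" using d1 d2 aD by fastforce
    moreover have "(Q1 \<union> Q2) \<inter> R = {}" using d1 d2 by (fastforce simp: R_def)
    ultimately have "card Q1 + card Q2 + card R = card (Q1 \<union> Q2 \<union> R)"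
      by (simp add: card_Un_disjoint Q1_def Q2_def R_def)
    also have "\<dots> \<le> card ({..<m} - {0, l})"
    proof (rule card_mono)
      have "0 \<notin> Q1" "l \<notin> Q2" by (auto simp: Q1_def Q2_def sep_def)
      moreover have "l \<notin> Q1" "0 \<notin> Q2" using d1 d2 aD by force+
      ultimately show "Q1 \<union> Q2 \<union> R \<subseteq> {..<m} - {0, l}" by (auto simp: Q1_def Q2_def R_def)
    qed simp
    also have "\<dots> = m - 2" using l by (simp add: card_Diff_subset)
    finally show ?thesis .
  qed
  have first: "card F \<le> D + 2 + 4 * card Q1 + 4 * card Q2"
  proof -
    \<comment> \<open>The parts are given by which of the two extreme rows a set contains;
      containing only the last one is excluded by \<open>no_l0\<close>.\<close>
    have "F \<subseteq> sep F 0 l \<union> {{}, {..<m}} \<union> N1 \<union> N2"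
      using no_l0 by (auto simp: sep_def N1_def N2_def)
    then have "card F \<le> card (sep F 0 l \<union> {{}, {..<m}} \<union> N1 \<union> N2)"
      by (rule card_mono[rotated]) (auto simp: N1_def N2_def finF finite_sep)
    also have "\<dots> \<le> card (sep F 0 l) + card {{}, {..<m}} + card N1 + card N2"
      by (meson add_mono card_Un_le order_refl order_trans)
    also have "card {{}, {..<m}} \<le> 2" by (simp add: card_insert_if)
    also have "card (sep F 0 l) = D"
      using row_degree_add_sep[OF finF, of 0 l] no_l0 aD by (simp add: a_def)
    finally show ?thesis using cN1 cN2 by simp
  qed
  \<comment> \<open>Walking down from row 0, rows within 6 of the top degree are free, and each
    further row is charged one drop of at most 6.\<close>
  have chain: "a 0 \<le> a k + 6 + 6 * card {i. i \<le> k \<and> a i + 7 \<le> a 0}" if "k < m" for k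
    using that
  proof (induction k)
    case (Suc k)
    show ?case
    proof (cases "a (Suc k) + 7 \<le> a 0")
      case True
      then have "{i. i \<le> Suc k \<and> a i + 7 \<le> a 0} = insert (Suc k) {i. i \<le> k \<and> a i + 7 \<le> a 0}"
        by (auto simp: le_Suc_eq)
      then have "card {i. i \<le> Suc k \<and> a i + 7 \<le> a 0} = Suc (card {i. i \<le> k \<and> a i + 7 \<le> a 0})"
        by simp
      then show ?thesis using Suc gap[of k] by (simp add: a_def)
    qed simp
  qed simp
  have mid: "D \<le> 18 + 6 * card R"
  proof -
    \<comment> \<open>The last row at least 7 above the bottom degree. The next row is at most 6
      above it, so \<open>a k \<le> a l + 12\<close>; with the 6 from \<open>chain\<close> this
      gives 18. The rows charged by \<open>chain\<close> up to \<open>k\<close> all lie in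
      \<open>R\<close>.\<close>
    define k where "k = Max {i. i < m \<and> a l + 7 \<le> a i}"
    have fin: "finite {i. i < m \<and> a l + 7 \<le> a i}" by simp
    have ne: "0 \<in> {i. i < m \<and> a l + 7 \<le> a i}" using aD l by simp
    have "k \<in> {i. i < m \<and> a l + 7 \<le> a i}" unfolding k_def using Max_in[OF fin] ne by blast
    then have k: "k < m" "a l + 7 \<le> a k" by auto
    have sk: "\<not> a l + 7 \<le> a (Suc k)" if "Suc k < m"
      using Max_ge[OF fin, of "Suc k"] that by (auto simp: k_def[symmetric])
    have "k \<noteq> l" using k by auto
    then have skm: "Suc k < m" using k l by simp
    have ak: "a k \<le> a l + 12" using sk[OF skm] gap[OF skm] by (simp add: a_def)
    have "{i. i \<le> k \<and> a i + 7 \<le> a 0} \<subseteq> R"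
    proof
      fix i assume "i \<in> {i. i \<le> k \<and> a i + 7 \<le> a 0}"
      then show "i \<in> R" using sorted[of i k] k by (auto simp: R_def a_def)
    qed
    then have "card {i. i \<le> k \<and> a i + 7 \<le> a 0} \<le> card R"
      by (rule card_mono[rotated]) (simp add: R_def)
    then show ?thesis using chain[OF k(1)] ak aD by linarith
  qed
  have second: "card F + D \<le> 8 * m - 6"
  proof -
    \<comment> \<open>A set without a position \<open>i \<notin> S\<close>,
      \<open>Suc i \<in> S\<close> is an initial segment, ending at its least non-element. There are
      \<open>m + 1\<close> initial segments.\<close>
    have "F \<subseteq> (\<lambda>k. {..<k}) ` {..m} \<union> (\<Union>i<l. sep F (Suc i) i)"
    proof
      fix S assume S: "S \<in> F"
      show "S \<in> (\<lambda>k. {..<k}) ` {..m} \<union> (\<Union>i<l. sep F (Suc i) i)"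
      proof (cases "\<exists>i<l. i \<notin> S \<and> Suc i \<in> S")
        case True
        then show ?thesis using S by (auto simp: sep_def)
      next
        case False
        define k where "k = (LEAST k. k \<notin> S)"
        have Sm: "S \<subseteq> {..<m}" using S F by auto
        then have "m \<notin> S" by auto
        then have k: "k \<notin> S" "k \<le> m"
          unfolding k_def by (rule LeastI[of "\<lambda>k. k \<notin> S"]) (rule Least_le, fact)
        have below: "i \<in> S" if "i < k" for i using not_less_Least that unfolding k_def by blast
        have above: "i \<notin> S" if "k \<le> i" for i using that
        proof (induction i rule: dec_induct)
          case (step n)
          show ?case
          proof (cases "n < l")
            case False
            then show ?thesis using Sm l by auto
          qed (use step \<open>\<not> (\<exists>i<l. i \<notin> S \<and> Suc i \<in> S)\<close> in auto)
        qed (rule k)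
        have "S = {..<k}" using below above by (meson lessThan_iff not_less subset_antisym subsetI)
        then show ?thesis using k by auto
      qed
    qed
    then have "card F \<le> card ((\<lambda>k. {..<k}) ` {..m} \<union> (\<Union>i<l. sep F (Suc i) i))"
      by (rule card_mono[rotated]) (auto simp: finite_sep finF)
    also have "\<dots> \<le> card ((\<lambda>k. {..<k}) ` {..m}) + card (\<Union>i<l. sep F (Suc i) i)"
      by (rule card_Un_le)
    also have "\<dots> \<le> card {..m} + (\<Sum>i<l. card (sep F (Suc i) i))"
      by (intro add_mono card_image_le card_UN_le) auto
    finally have "card F \<le> m + 1 + (\<Sum>i<l. card (sep F (Suc i) i))" by simp
    \<comment> \<open>Each inversion count is at most 7 minus the drop in degree, and the drops
      telescope to \<open>D\<close>. If the count is zero, \<open>gap\<close> gives this with one to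
      spare.\<close>
    moreover have "(\<Sum>i<k. card (sep F (Suc i) i)) + a 0 \<le> 7 * k + a k" if "k < m" for k
      using that
    proof (induction k)
      case (Suc k)
      have "card (sep F (Suc k) k) + a k \<le> 7 + a (Suc k)"
      proof (cases "sep F (Suc k) k = {}")
        case True
        then show ?thesis using gap[OF Suc.prems] by (simp add: a_def)
      next
        case False
        then have "card (sep F k (Suc k)) \<le> 7" using fam Suc.prems by (auto simp: family_def)
        then show ?thesis using row_degree_add_sep[OF finF, of k "Suc k"] by (simp add: a_def)
      qed
      then show ?case using Suc by simp
    qed simp
    from this[OF l(1)] have "(\<Sum>i<l. card (sep F (Suc i) i)) + D \<le> 7 * l" using aD by simp
    ultimately show ?thesis using l by simp
  qed
  \<comment> \<open>Using \<open>cQ\<close> and \<open>mid\<close> to eliminate the cardinalities of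
    \<open>Q1\<close>, \<open>Q2\<close> and \<open>R\<close>, three times \<open>first\<close> plus
    \<open>second\<close> cancels \<open>D\<close> and leaves
    \<open>4 * card F \<le> 20 * m + 12\<close>. Finally
    \<open>5 * (5 * m + 3) \<le> 27 * m + 5\<close> holds from \<open>m = 5\<close> on.\<close>
  show ?thesis using first mid second cQ m by linarith
qed

section \<open>Splitting at a cut, and the induction on the number of rows\<close>

lemma card_family_split:
  assumes fam: "family m G" and k: "0 < k" "k < m"
    and split: "\<And>i j. i < k \<Longrightarrow> k \<le> j \<Longrightarrow> j < m \<Longrightarrow> sep G j i = {}"
    and IH: "\<And>n F. n < m \<Longrightarrow> family n F \<Longrightarrow> 5 * card F \<le> 27 * n + 5"
  shows "5 * card G \<le> 27 * m + 5"
proof -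
  text \<open>Adjoining the prefix preserves the property and makes the two parts overlap, which saves one
    of the two additive constants.\<close>
  define H where "H = insert {..<k} G"
  have splitH: "sep H j i = {}" if "i < k" "k \<le> j" "j < m" for i j
    using split[OF that] that by (auto simp: sep_def H_def)
  have same: "sep H i j = sep G i j" if "(i < k) = (j < k)" for i j
    using that by (auto simp: sep_def H_def)
  have famH: "family m H"
    unfolding family_def
  proof (intro conjI allI impI)
    show "H \<subseteq> Pow {..<m}" using fam k by (auto simp: H_def family_def)
    fix i j assume ij: "i < m" "j < m" "sep H j i \<noteq> {}"
    consider "i < k" "k \<le> j" | "j < k" "k \<le> i" | "(i < k) = (j < k)" by linarith
    then show "card (sep H i j) \<le> 7"
    proof cases
      case 3
      then show ?thesis using same[of i j] same[of j i] fam ij by (auto simp: family_def)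
    qed (use splitH ij in auto)
  qed
  have finH: "finite H" and H: "H \<subseteq> Pow {..<m}" using famH family_finite by (auto simp: family_def)
  define G1 where "G1 = {S \<in> H. S \<subseteq> {..<k}}"
  define G2 where "G2 = {S \<in> H. {..<k} \<subseteq> S}"
  define h where "h i = i + k" for i
  have inj: "inj_on (pull (m - k) h) G2"
  proof (rule inj_onI)
    fix S T assume ST: "S \<in> G2" "T \<in> G2" "pull (m - k) h S = pull (m - k) h T"
    \<comment> \<open>A member of \<open>G2\<close> contains the whole prefix, so it is determined
      by its rows from \<open>k\<close> on.\<close>
    have rec: "U = {..<k} \<union> h ` pull (m - k) h U" if "U \<in> G2" for U
    proof (intro equalityI subsetI)
      fix x assume x: "x \<in> U"
      then have "x < m" using that H by (auto simp: G2_def)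
      show "x \<in> {..<k} \<union> h ` pull (m - k) h U"
      proof (cases "x < k")
        case False
        then have "x = h (x - k)" "x - k \<in> pull (m - k) h U"
          using x \<open>x < m\<close> by (auto simp: h_def pull_def)
        then show ?thesis by blast
      qed simp
    qed (use that in \<open>auto simp: G2_def pull_def\<close>)
    show "S = T" using rec[OF ST(1)] rec[OF ST(2)] ST(3) by simp
  qed
  have "family (m - k) (pull (m - k) h ` G2)"
    by (rule family_pull[OF family_subset[OF famH] inj]) (auto simp: G2_def h_def)
  then have "5 * card (pull (m - k) h ` G2) \<le> 27 * (m - k) + 5"
    using k by (intro IH) auto
  then have b2: "5 * card G2 \<le> 27 * (m - k) + 5" by (simp add: card_image[OF inj])
  have "family m G1" by (rule family_subset[OF famH]) (auto simp: G1_def)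
  then have "family k G1" using k by (auto simp: family_def G1_def)
  then have b1: "5 * card G1 \<le> 27 * k + 5" using k by (intro IH)
  \<comment> \<open>A set that neither lies in the prefix nor contains it would be an inversion
    across the cut.\<close>
  have un: "H \<subseteq> G1 \<union> G2"
  proof
    fix S assume S: "S \<in> H"
    show "S \<in> G1 \<union> G2"
    proof (rule ccontr)
      assume "S \<notin> G1 \<union> G2"
      then have "\<not> S \<subseteq> {..<k}" "\<not> {..<k} \<subseteq> S" using S by (auto simp: G1_def G2_def)
      then obtain i j where "i < k" "i \<notin> S" "j \<in> S" "k \<le> j"
        by (metis lessThan_iff not_less subsetI)
      moreover from this have "j < m" using S H by auto
      ultimately show False using splitH[of i j] S by (auto simp: sep_def)
    qed
  qed
  have fin12: "finite G1" "finite G2" using finH by (auto simp: G1_def G2_def)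
  have "{..<k} \<in> G1" "{..<k} \<in> G2" by (auto simp: G1_def G2_def H_def)
  then have "G1 \<inter> G2 \<noteq> {}" by blast
  then have "card (G1 \<inter> G2) > 0" using fin12 by (simp add: card_gt_0_iff)
  moreover have "card G \<le> card (G1 \<union> G2)"
    using un fin12 by (intro card_mono) (auto simp: H_def)
  ultimately show ?thesis
    using card_Un_Int[OF fin12] b1 b2 k by linarith
qed

lemma card_family_le: "family m F \<Longrightarrow> 5 * card F \<le> 27 * m + 5"
proof (induction m arbitrary: F rule: less_induct)
  case (less m)
  show ?case
  proof (cases "m \<le> 5")
    case True
    then show ?thesis using card_family_small less.prems by blast
  next
    case False
    then have m: "6 \<le> m" by simp
    obtain G where fam: "family m G" and cardG: "card G = card F"
      and sorted: "\<And>i j. i \<le> j \<Longrightarrow> j < m \<Longrightarrow> row_degree G j \<le> row_degree G i"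
      using sort_family[OF less.prems] by blast
    have finG: "finite G" and G: "G \<subseteq> Pow {..<m}" using fam family_finite by (auto simp: family_def)
    show ?thesis
    proof (cases "\<exists>k. 0 < k \<and> k < m \<and> (\<forall>i<k. \<forall>j. k \<le> j \<and> j < m \<longrightarrow> sep G j i = {})")
      case True
      then obtain k where k: "0 < k" "k < m"
        and split: "\<And>i j. i < k \<Longrightarrow> k \<le> j \<Longrightarrow> j < m \<Longrightarrow> sep G j i = {}" by blast
      then have "5 * card G \<le> 27 * m + 5"
        using card_family_split[OF fam] less.IH by blast
      then show ?thesis using cardG by simp
    next
      case False
      \<comment> \<open>Some inverted pair \<open>x \<le> i < y\<close> crosses the cut after row
        \<open>i\<close>. Its degrees differ by at most 6, and by sortedness they enclose those of
        \<open>i\<close> and \<open>Suc i\<close>.\<close>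
      have gap: "row_degree G i \<le> row_degree G (Suc i) + 6" if i: "Suc i < m" for i
      proof -
        have "\<exists>x<Suc i. \<exists>y. Suc i \<le> y \<and> y < m \<and> sep G y x \<noteq> {}"
          using False i by blast
        then obtain x y where xy: "x \<le> i" "Suc i \<le> y" "y < m" "sep G y x \<noteq> {}"
          unfolding less_Suc_eq_le by blast
        have "card (sep G x y) \<le> 7" using fam xy by (auto simp: family_def)
        moreover have "1 \<le> card (sep G y x)"
          using xy finite_sep[OF finG] by (simp add: Suc_le_eq card_gt_0_iff)
        ultimately have "row_degree G x \<le> row_degree G y + 6" using row_degree_add_sep[OF finG, of x y] by simp
        then show ?thesis using sorted[of x i] sorted[of "Suc i" y] xy i by simp
      qed
      show ?thesis
      proof (cases "row_degree G (m - 1) + 15 \<le> row_degree G 0")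
        case True
        then show ?thesis using card_family_steep[OF fam m sorted gap] cardG by simp
      next
        case False
        \<comment> \<open>If one direction is empty, the sum is the difference of the degrees, at
          most 14; otherwise each direction is at most 7.\<close>
        have two: "card (sep G i j) + card (sep G j i) \<le> 14" if ij: "i \<le> j" "j < m" for i j
        proof (cases "sep G j i = {} \<or> sep G i j = {}")
          case True
          have "row_degree G i \<le> row_degree G j + 14"
            using False sorted[of 0 i] sorted[of j "m - 1"] ij m by linarith
          moreover have "row_degree G j \<le> row_degree G i" using sorted ij by simp
          ultimately show ?thesis using row_degree_add_sep[OF finG, of i j] True by auto
        next
          case False
          then have "card (sep G i j) \<le> 7" "card (sep G j i) \<le> 7"
            using fam ij by (auto simp: family_def)
          then show ?thesis by simp
        qed
        have "5 * card G \<le> 27 * m + 5"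
        proof (rule card_family_flat[OF G m])
          fix i j assume "i < m" "j < m"
          then show "card (sep G i j) + card (sep G j i) \<le> 14"
            using two[of i j] two[of j i] by (cases "i \<le> j") auto
        qed
        then show ?thesis using cardG by simp
      qed
    qed
  qed
qed

section \<open>Translation between matrices and families\<close>

lemma F_0p10_entries:
  "c < p \<Longrightarrow> F_0p10 p $$ (0, c) = 1" "c < p \<Longrightarrow> F_0p10 p $$ (Suc 0, c) = 0"
  "F_0p10 p $$ (0, p) = 0" "F_0p10 p $$ (Suc 0, p) = 1"
  "dim_row (F_0p10 p) = 2" "dim_col (F_0p10 p) = Suc p"
  by (simp_all add: F_0p10_def)

lemma configuration_F_0p10_imp:
  assumes "configuration (F_0p10 p) A"
  obtains i j c where "i < dim_row A" "j < dim_row A" "c < dim_col A"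
    "A $$ (i, c) = 0" "A $$ (j, c) = 1"
    "p \<le> card {c. c < dim_col A \<and> A $$ (i, c) = 1 \<and> A $$ (j, c) = 0}"
proof -
  let ?F = "F_0p10 p"
  obtain I J \<pi> \<sigma> where \<pi>: "\<pi> permutes {..<2}" and \<sigma>: "\<sigma> permutes {..<Suc p}"
    and eq: "submatrix A I J = mat 2 (Suc p) (\<lambda>(i, j). ?F $$ (\<pi> i, \<sigma> j))"
    using assms unfolding configuration_def row_col_perm_def by (auto simp: F_0p10_entries)
  have cI: "card {i. i < dim_row A \<and> i \<in> I} = 2"
    using arg_cong[OF eq, of dim_row] by (simp add: dim_submatrix)
  have cJ: "card {j. j < dim_col A \<and> j \<in> J} = Suc p"
    using arg_cong[OF eq, of dim_col] by (simp add: dim_submatrix)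
  \<comment> \<open>The inverse permutations locate the rows and columns of \<open>?F\<close> inside
    the submatrix; \<open>pick\<close> then carries these positions to indices of
    \<open>A\<close>.\<close>
  define \<pi>' where "\<pi>' = inv_into UNIV \<pi>"
  define \<sigma>' where "\<sigma>' = inv_into UNIV \<sigma>"
  have \<pi>': "\<pi>' permutes {..<2}" and \<sigma>': "\<sigma>' permutes {..<Suc p}"
    using permutes_inv[OF \<pi>] permutes_inv[OF \<sigma>] by (simp_all add: \<pi>'_def \<sigma>'_def)
  have undo: "\<pi> (\<pi>' r) = r" "\<sigma> (\<sigma>' c) = c" for r c
    using permutes_inverses(1)[OF \<pi>] permutes_inverses(1)[OF \<sigma>] by (simp_all add: \<pi>'_def \<sigma>'_def)
  define row where "row r = pick I (\<pi>' r)" for r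
  define column where "column c = pick J (\<sigma>' c)" for c
  have bound\<pi>: "\<pi>' r < 2" if "r < 2" for r
    using permutes_in_image[OF \<pi>', of r] that by simp
  have bound\<sigma>: "\<sigma>' c < Suc p" if "c < Suc p" for c
    using permutes_in_image[OF \<sigma>', of c] that by simp
  have row: "row r < dim_row A" if "r < 2" for r
    unfolding row_def using bound\<pi>[OF that] cI by (intro pick_le) simp
  have column: "column c < dim_col A" if "c < Suc p" for c
    unfolding column_def using bound\<sigma>[OF that] cJ by (intro pick_le) simp
  have entry: "A $$ (row r, column c) = ?F $$ (r, c)" if "r < 2" "c < Suc p" for r c
  proof -
    have "A $$ (row r, column c) = submatrix A I J $$ (\<pi>' r, \<sigma>' c)"
      unfolding row_def column_def
      using bound\<pi>[OF that(1)] bound\<sigma>[OF that(2)] cI cJ by (intro submatrix_index[symmetric]) auto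
    also have "\<dots> = ?F $$ (r, c)"
      unfolding eq using bound\<pi>[OF that(1)] bound\<sigma>[OF that(2)]
      by (simp add: undo)
    finally show ?thesis .
  qed
  have inj: "inj_on column {..<p}"
  proof (rule inj_onI)
    fix c d assume cd: "c \<in> {..<p}" "d \<in> {..<p}" "column c = column d"
    \<comment> \<open>\<open>J\<close> may be infinite, since \<open>submatrix\<close> reads only
      its part below \<open>dim_col A\<close>; monotonicity of \<open>pick\<close> therefore needs
      both alternatives.\<close>
    have "Suc p \<le> card J \<or> infinite J"
      using card_mono[of J "{j. j < dim_col A \<and> j \<in> J}"] cJ by auto
    then have mono: "pick J x < pick J y" if "x < y" "y < Suc p" for x y
      using that by (intro pick_mono) auto
    have "\<sigma>' c = \<sigma>' d"
      using cd mono[of "\<sigma>' c" "\<sigma>' d"] mono[of "\<sigma>' d" "\<sigma>' c"] bound\<sigma>[of c] bound\<sigma>[of d]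
      unfolding column_def by (metis lessThan_iff less_Suc_eq less_irrefl linorder_neqE_nat)
    then show "c = d" by (metis undo(2))
  qed
  have "p = card (column ` {..<p})" by (simp add: card_image[OF inj])
  also have "\<dots> \<le> card {c. c < dim_col A \<and> A $$ (row 0, c) = 1 \<and> A $$ (row 1, c) = 0}"
  proof (rule card_mono)
    show "column ` {..<p} \<subseteq> {c. c < dim_col A \<and> A $$ (row 0, c) = 1 \<and> A $$ (row 1, c) = 0}"
    proof
      fix k assume "k \<in> column ` {..<p}"
      then obtain c where c: "c < p" "k = column c" by blast
      then show "k \<in> {c. c < dim_col A \<and> A $$ (row 0, c) = 1 \<and> A $$ (row 1, c) = 0}"
        using column[of c] entry[of 0 c] entry[of 1 c] by (simp add: F_0p10_entries)
    qed
  qed simp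
  finally have "p \<le> card {c. c < dim_col A \<and> A $$ (row 0, c) = 1 \<and> A $$ (row 1, c) = 0}" .
  moreover have "A $$ (row 0, column p) = 0" "A $$ (row 1, column p) = 1"
    using entry[of 0 p] entry[of 1 p] by (simp_all add: F_0p10_entries)
  moreover have "row 0 < dim_row A" "row 1 < dim_row A" "column p < dim_col A"
    by (simp_all add: row column)
  ultimately show ?thesis using that by blast
qed

lemma configuration_F_0p10_intro:
  assumes ij: "i < dim_row A" "j < dim_row A" and c: "c < dim_col A"
    and Ac: "A $$ (i, c) = 0" "A $$ (j, c) = 1"
    and p: "p \<le> card {c. c < dim_col A \<and> A $$ (i, c) = 1 \<and> A $$ (j, c) = 0}"
  shows "configuration (F_0p10 p) A"
proof -
  let ?F = "F_0p10 p"
  \<comment> \<open>Exactly \<open>p\<close> of the available columns are kept, so that together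
    with \<open>c\<close> the submatrix gets \<open>p + 1\<close> columns.\<close>
  obtain C where C: "C \<subseteq> {c. c < dim_col A \<and> A $$ (i, c) = 1 \<and> A $$ (j, c) = 0}"
    and cC: "card C = p"
    using obtain_subset_with_card_n[OF p] by blast
  have finC: "finite C" by (rule finite_subset[OF C]) simp
  have cC0: "c \<notin> C" using C Ac by auto
  have neq: "i \<noteq> j" using Ac by auto
  define I where "I = {i, j}"
  define J where "J = insert c C"
  have cJ: "card J = Suc p" and finJ: "finite J" using cC cC0 finC by (auto simp: J_def)
  have JA: "{k. k < dim_col A \<and> k \<in> J} = J" using C c by (auto simp: J_def)
  have IA: "{k. k < dim_row A \<and> k \<in> I} = I" using ij by (auto simp: I_def)
  have cI: "card I = 2" using neq by (simp add: I_def)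
  define pos where "pos = card {k \<in> J. k < c}"
  have pick_pos: "pick J pos = c" unfolding pos_def by (rule pick_card_in_set) (simp add: J_def)
  have "{k \<in> J. k < c} \<subset> J" by (auto simp: J_def)
  then have pos: "pos < Suc p" using psubset_card_mono[OF finJ] cJ by (metis pos_def)
  \<comment> \<open>\<open>submatrix\<close> lists indices in increasing order, so \<open>c\<close>
    lands at \<open>pos\<close> and must be exchanged with the last column of \<open>?F\<close>. The
    rows are exchanged exactly when \<open>j < i\<close>.\<close>
  define \<sigma> where "\<sigma> = transpose pos p"
  define \<pi> where "\<pi> = (if i < j then id else transpose 0 (1::nat))"
  have \<pi>: "\<pi> permutes {..<2}" unfolding \<pi>_def by (simp add: permutes_id permutes_swap_id)
  have \<sigma>: "\<sigma> permutes {..<Suc p}" unfolding \<sigma>_def using pos by (intro permutes_swap_id) auto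
  have pick_row: "pick I r = (if \<pi> r = 0 then i else j)" if "r < 2" for r
  proof -
    have "pick I (card {a \<in> I. a < i}) = i" "pick I (card {a \<in> I. a < j}) = j"
      by (rule pick_card_in_set, simp add: I_def)+
    moreover have "card {a \<in> I. a < i} = (if i < j then 0 else 1)"
    proof (cases "i < j")
      case False
      then have "{a \<in> I. a < i} = {j}" using neq by (auto simp: I_def)
      then show ?thesis using False by simp
    next
      case True
      then have "{a \<in> I. a < i} = {}" by (auto simp: I_def)
      then show ?thesis using True by (metis card.empty)
    qed
    moreover have "card {a \<in> I. a < j} = (if i < j then 1 else 0)"
    proof (cases "i < j")
      case True
      then have "{a \<in> I. a < j} = {i}" by (auto simp: I_def)
      then show ?thesis using True by simp
    next
      case False
      then have "{a \<in> I. a < j} = {}" by (auto simp: I_def)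
      then show ?thesis using False by (metis card.empty)
    qed
    moreover have "r = 0 \<or> r = 1" using that by linarith
    ultimately show ?thesis by (auto simp: \<pi>_def split: if_splits)
  qed
  have "submatrix A I J = mat 2 (Suc p) (\<lambda>(r, k). ?F $$ (\<pi> r, \<sigma> k))"
  proof (rule eq_matI)
    fix r k assume "r < dim_row (mat 2 (Suc p) (\<lambda>(r, k). ?F $$ (\<pi> r, \<sigma> k)))"
      "k < dim_col (mat 2 (Suc p) (\<lambda>(r, k). ?F $$ (\<pi> r, \<sigma> k)))"
    then have rk: "r < 2" "k < Suc p" by auto
    have pr: "\<pi> r = 0 \<or> \<pi> r = Suc 0"
      using permutes_in_image[OF \<pi>, of r] rk(1) by auto
    have "A $$ (pick I r, pick J k) = ?F $$ (\<pi> r, \<sigma> k)"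
    proof (cases "k = pos")
      case True
      then show ?thesis using pr rk Ac by (auto simp: pick_row pick_pos \<sigma>_def F_0p10_entries)
    next
      case False
      have "pick J k \<in> J" using rk cJ by (intro pick_in_set_le) simp
      moreover have "pick J k \<noteq> c"
        using False pick_mono_le[of k J pos] pick_mono_le[of pos J k] rk pos cJ pick_pos
        by (metis less_irrefl linorder_neqE_nat)
      ultimately have "pick J k \<in> C" by (simp add: J_def)
      then have "A $$ (i, pick J k) = 1" "A $$ (j, pick J k) = 0" using C by auto
      moreover have "\<sigma> k < p"
      proof -
        have "\<sigma> k < Suc p" using permutes_in_image[OF \<sigma>, of k] rk by simp
        moreover have "\<sigma> k \<noteq> p" using False by (auto simp: \<sigma>_def transpose_def split: if_splits)
        ultimately show ?thesis by simp
      qed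
      ultimately show ?thesis using pr rk by (auto simp: pick_row F_0p10_entries)
    qed
    then show "submatrix A I J $$ (r, k) = mat 2 (Suc p) (\<lambda>(r, k). ?F $$ (\<pi> r, \<sigma> k)) $$ (r, k)"
      using rk by (simp add: submatrix_def IA JA cI cJ)
  qed (simp_all add: dim_submatrix IA JA cI cJ)
  then show ?thesis
    unfolding configuration_def row_col_perm_def using \<pi> \<sigma> by (auto simp: F_0p10_entries)
qed

lemma simple_mat_entries:
  assumes "simple_mat A" "i < dim_row A" "j < dim_col A"
  shows "A $$ (i, j) = 0 \<or> A $$ (i, j) = 1"
  using assms elements_matI[OF carrier_matI[OF refl refl] assms(2,3) refl]
  unfolding simple_mat_def by blast

text \<open>The family consists of the supports of the columns. Entries are 0 or 1, so distinct
  columns have distinct supports, and column counts become separation counts.\<close>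

lemma Avoid_imp_family:
  assumes "A \<in> Avoid m (F_0p10 8)"
  obtains F where "family m F" "card F = dim_col A"
proof -
  have m: "dim_row A = m" and simple: "simple_mat A" and avoid: "\<not> configuration (F_0p10 8) A"
    using assms by (auto simp: Avoid_def)
  define support where "support c = {i. i < m \<and> A $$ (i, c) = 1}" for c
  have inj: "inj_on support {..<dim_col A}"
  proof (rule inj_onI)
    fix c d assume cd: "c \<in> {..<dim_col A}" "d \<in> {..<dim_col A}" "support c = support d"
    have "A $$ (i, c) = A $$ (i, d)" if "i < m" for i
    proof -
      have "A $$ (i, c) = 1 \<longleftrightarrow> A $$ (i, d) = 1" using cd(3) that by (auto simp: support_def set_eq_iff)
      moreover have "A $$ (i, c) = 0 \<or> A $$ (i, c) = 1" "A $$ (i, d) = 0 \<or> A $$ (i, d) = 1"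
        using simple_mat_entries[OF simple] that m cd(1,2) by simp_all
      ultimately show ?thesis by auto
    qed
    then have "cols A ! c = cols A ! d" using cd m by (auto intro!: eq_vecI)
    then show "c = d" using simple cd nth_eq_iff_index_eq[of "cols A" c d] by (simp add: simple_mat_def)
  qed
  have card_sep: "card (sep (support ` {..<dim_col A}) i j) =
      card {c. c < dim_col A \<and> A $$ (i, c) = 1 \<and> A $$ (j, c) = 0}" if "i < m" "j < m" for i j
  proof -
    let ?C = "{c. c < dim_col A \<and> A $$ (i, c) = 1 \<and> A $$ (j, c) = 0}"
    have "sep (support ` {..<dim_col A}) i j = support ` ?C"
      using that simple_mat_entries[OF simple, of j] m unfolding sep_def support_def by fastforce
    moreover have "inj_on support ?C" using inj by (rule inj_on_subset) auto
    ultimately show ?thesis by (simp add: card_image)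
  qed
  show ?thesis
  proof
    show "card (support ` {..<dim_col A}) = dim_col A" by (simp add: card_image[OF inj])
    show "family m (support ` {..<dim_col A})"
      unfolding family_iff_card
    proof (intro conjI allI impI)
      show "support ` {..<dim_col A} \<subseteq> Pow {..<m}" by (auto simp: support_def)
      fix i j assume ij: "i < m" "j < m" "0 < card (sep (support ` {..<dim_col A}) j i)"
      then have "0 < card {c. c < dim_col A \<and> A $$ (j, c) = 1 \<and> A $$ (i, c) = 0}"
        using card_sep[of j i] by simp
      then obtain c where c: "c < dim_col A" "A $$ (j, c) = 1" "A $$ (i, c) = 0"
        unfolding card_gt_0_iff by blast
      show "card (sep (support ` {..<dim_col A}) i j) \<le> 7"
      proof (rule ccontr)
        assume "\<not> ?thesis"
        then have "8 \<le> card {c. c < dim_col A \<and> A $$ (i, c) = 1 \<and> A $$ (j, c) = 0}"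
          using card_sep[of i j] ij by simp
        then have "configuration (F_0p10 8) A"
          using ij m c by (intro configuration_F_0p10_intro[of i A j c]) simp_all
        then show False using avoid by simp
      qed
    qed
  qed
qed

text \<open>The matrix is the incidence matrix of the family, with its sets listed in any
  order.\<close>

lemma family_imp_Avoid:
  assumes "family m F"
  obtains A where "A \<in> Avoid m (F_0p10 8)" "dim_col A = card F"
proof -
  obtain xs where xs: "set xs = F" "distinct xs"
    using finite_distinct_list[OF family_finite[OF assms]] by blast
  have len: "length xs = card F" using distinct_card[OF xs(2)] xs(1) by simp
  define A where "A = mat m (length xs) (\<lambda>(i, c). if i \<in> xs ! c then 1 else 0 :: nat)"
  have dims: "dim_row A = m" "dim_col A = length xs" by (simp_all add: A_def)
  have entry: "A $$ (i, c) = (if i \<in> xs ! c then 1 else 0)" if "i < m" "c < length xs" for i c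
    using that by (simp add: A_def)
  have sub: "xs ! c \<subseteq> {..<m}" if "c < length xs" for c
  proof -
    have "xs ! c \<in> F" using that xs nth_mem by blast
    then show ?thesis using assms by (auto simp: family_def)
  qed
  have "distinct (cols A)"
    unfolding distinct_conv_nth
  proof (intro allI impI notI)
    fix c d assume cd: "c < length (cols A)" "d < length (cols A)" "c \<noteq> d" "cols A ! c = cols A ! d"
    then have cd': "c < length xs" "d < length xs" using dims by auto
    have "i \<in> xs ! c \<longleftrightarrow> i \<in> xs ! d" if "i < m" for i
    proof -
      have "A $$ (i, c) = A $$ (i, d)"
        using arg_cong[OF cd(4), of "\<lambda>v. v $ i"] cd' that dims by simp
      then show ?thesis using entry cd' that by (simp split: if_splits)
    qed
    then have "xs ! c = xs ! d" using sub[OF cd'(1)] sub[OF cd'(2)] by auto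
    then show False using xs(2) cd' cd(3) by (simp add: nth_eq_iff_index_eq)
  qed
  moreover have "elements_mat A \<subseteq> {0, 1}"
    using entry dims by (auto dest!: elements_matD split: if_splits)
  ultimately have "simple_mat A" by (simp add: simple_mat_def)
  moreover have "\<not> configuration (F_0p10 8) A"
  proof
    assume conf: "configuration (F_0p10 8) A"
    obtain i j c where ij: "i < m" "j < m" and c: "c < length xs" "A $$ (i, c) = 0" "A $$ (j, c) = 1"
      and eight: "8 \<le> card {c. c < length xs \<and> A $$ (i, c) = 1 \<and> A $$ (j, c) = 0}"
      using configuration_F_0p10_imp[OF conf, unfolded dims] .
    have support: "i \<in> xs ! c \<longleftrightarrow> A $$ (i, c) = 1" if "i < m" "c < length xs" for i c
      unfolding entry[OF that] by simp
    have mem: "xs ! c \<in> F" if "c < length xs" for c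
      using nth_mem[OF that] xs(1) by blast
    have "i \<notin> xs ! c" "j \<in> xs ! c"
      unfolding support[OF ij(1) c(1)] support[OF ij(2) c(1)] c(2,3) by (rule zero_neq_one, rule refl)
    then have "xs ! c \<in> sep F j i" using mem[OF c(1)] unfolding sep_def by blast
    then have seven: "card (sep F i j) \<le> 7" using assms ij unfolding family_def by blast
    let ?C = "{c. c < length xs \<and> A $$ (i, c) = 1 \<and> A $$ (j, c) = 0}"
    have "inj_on ((!) xs) ?C" using xs(2) by (auto simp: inj_on_def nth_eq_iff_index_eq)
    then have "card ?C = card ((!) xs ` ?C)" by (simp add: card_image)
    also have "\<dots> \<le> card (sep F i j)"
    proof (rule card_mono[OF finite_sep[OF family_finite[OF assms]]])
      show "(!) xs ` ?C \<subseteq> sep F i j"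
      proof
        fix S assume "S \<in> (!) xs ` ?C"
        then obtain k where k: "k < length xs" "A $$ (i, k) = 1" "A $$ (j, k) = 0" "S = xs ! k" by blast
        have "i \<in> S" "j \<notin> S"
          unfolding k(4) support[OF ij(1) k(1)] support[OF ij(2) k(1)] k(2,3)
          by (rule refl, rule zero_neq_one)
        then show "S \<in> sep F i j" using mem[OF k(1)] k(4) unfolding sep_def by blast
      qed
    qed
    finally show False using eight seven by simp
  qed
  ultimately show ?thesis using that[of A] dims len by (simp add: Avoid_def)
qed

section \<open>The extremal construction for multiples of five\<close>

text \<open>The empty and the full set are deliberately not omitted: stacked copies are glued along
  them.\<close>

definition block :: "nat set set" where
  "block = Pow {..<5} - {{0, 1, 2}, {0, 3, 4}, {1, 3}, {2, 4}}"

text \<open>The four omitted sets separate every ordered pair of rows because the five rows correspond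
  to distinct 2-subsets of these four sets.\<close>
lemma family_block: "family 5 block"
  unfolding family_def
proof (intro conjI allI impI)
  show "block \<subseteq> Pow {..<5}" by (auto simp: block_def)
  fix i j :: nat assume ij: "i < 5" "j < 5" "sep block j i \<noteq> {}"
  let ?R = "{{0, 1, 2}, {0, 3, 4}, {1, 3}, {2, 4}} :: nat set set"
  have neq: "i \<noteq> j" using ij by (auto simp: sep_def)
  have "i \<in> {0, 1, 2, 3, 4}" "j \<in> {0, 1, 2, 3, 4}"
    using ij(1,2) by (simp_all add: numeral_eq_Suc less_Suc_eq)
  then have "\<exists>S\<in>?R. i \<in> S \<and> j \<notin> S"
    using neq by (elim insertE emptyE) simp_all
  then obtain S where S: "S \<in> ?R" "i \<in> S" "j \<notin> S" by blast
  moreover have "?R \<subseteq> Pow {..<5}" by simp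
  ultimately have "S \<in> Pow {..<5}" by blast
  then have SP: "S \<in> sep (Pow {..<5}) i j" using S(2,3) by (simp add: sep_def)
  have "sep block i j \<subseteq> sep (Pow {..<5}) i j - {S}" using S(1) unfolding sep_def block_def by blast
  then have "card (sep block i j) \<le> card (sep (Pow {..<5}) i j - {S})"
    by (rule card_mono[rotated]) (simp add: sep_def)
  also have "\<dots> = 7" using SP card_sep_Pow[of "{..<5}" i j] ij neq by simp
  finally show "card (sep block i j) \<le> 7" .
qed

lemma card_block: "card block = 28"
proof -
  let ?R = "{{0, 1, 2}, {0, 3, 4}, {1, 3}, {2, 4}} :: nat set set"
  have sub: "?R \<subseteq> Pow {..<5}" by simp
  have ne: "A \<noteq> B" if "x \<in> A" "x \<notin> B" for x :: nat and A B using that by blast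
  have "{0, 1, 2} \<noteq> {0, 3, 4 :: nat}"
    "{0, 1, 2} \<noteq> {1, 3 :: nat}"
    "{0, 1, 2} \<noteq> {2, 4 :: nat}"
    "{0, 3, 4} \<noteq> {1, 3 :: nat}"
    "{0, 3, 4} \<noteq> {2, 4 :: nat}"
    "{1, 3} \<noteq> {2, 4 :: nat}"
    using ne[of 1 "{0, 1, 2}" "{0, 3, 4}"]
      ne[of 0 "{0, 1, 2}" "{1, 3}"]
      ne[of 0 "{0, 1, 2}" "{2, 4}"]
      ne[of 0 "{0, 3, 4}" "{1, 3}"]
      ne[of 0 "{0, 3, 4}" "{2, 4}"]
      ne[of 1 "{1, 3}" "{2, 4}"]
    by simp_all
  then have "card ?R = 4" by simp
  then show ?thesis using card_Diff_subset[OF _ sub] by (simp add: block_def card_Pow)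
qed

text \<open>A copy of \<open>block\<close> on five new rows is added, each of its sets joined with
  all old rows. The two parts share only \<open>{..<m}\<close>, the image of the empty set, hence 28
  - 1 = 27 new sets. The full set is kept so that the step can be repeated.\<close>

lemma family_extend:
  assumes fam: "family m F" and top: "{..<m} \<in> F"
  obtains G where "family (m + 5) G" "card G = card F + 27" "{..<m + 5} \<in> G"
proof -
  define lift where "lift S = {..<m} \<union> (\<lambda>i. i + m) ` S" for S
  define H where "H = lift ` block"
  have F: "F \<subseteq> Pow {..<m}" using fam by (simp add: family_def)
  have blk: "block \<subseteq> Pow {..<5}" "finite block" using family_block family_finite by (auto simp: family_def)
  have lift_low: "i \<in> lift S" if "i < m" for i S using that by (simp add: lift_def)
  have lift_high: "i \<in> lift S \<longleftrightarrow> i - m \<in> S" if "m \<le> i" for i S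
    using that by (force simp: lift_def)
  have inj: "inj lift"
  proof (rule injI)
    fix S T assume "lift S = lift T"
    then have "i \<in> S \<longleftrightarrow> i \<in> T" for i
      using lift_high[of "i + m" S] lift_high[of "i + m" T] by simp
    then show "S = T" by blast
  qed
  have lift_top: "lift {..<5} = {..<m + 5}"
  proof (rule Set.set_eqI)
    show "i \<in> lift {..<5} \<longleftrightarrow> i \<in> {..<m + 5}" for i
    proof (cases "i < m")
      case False
      then have "i \<in> lift {..<5} \<longleftrightarrow> i - m < 5" using lift_high[of i] by simp
      then show ?thesis using False by auto
    qed (simp add: lift_low)
  qed
  have "lift S \<subseteq> lift {..<5}" if "S \<in> block" for S
  proof -
    have "S \<subseteq> {..<5}" using that blk(1) by blast
    then show ?thesis unfolding lift_def by blast
  qed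
  then have H: "H \<subseteq> Pow {..<m + 5}" unfolding H_def lift_top by blast
  have "F \<inter> H = {{..<m}}"
  proof (intro equalityI subsetI)
    fix S assume "S \<in> F \<inter> H"
    then show "S \<in> {{..<m}}" using F by (auto simp: H_def lift_def)
  next
    fix S assume "S \<in> {{..<m}}"
    moreover have "{..<m} = lift {}" "{} \<in> block" by (auto simp: lift_def block_def)
    ultimately show "S \<in> F \<inter> H" using top by (auto simp: H_def)
  qed
  moreover have "card H = 28" unfolding H_def using inj card_block by (simp add: card_image inj_on_subset)
  moreover have "finite F" "finite H" using family_finite[OF fam] blk by (auto simp: H_def)
  ultimately have card: "card (F \<union> H) = card F + 27" using card_Un_Int[of F H] by simp
  have out: "i \<notin> S" if "S \<in> F" "m \<le> i" for i S
  proof -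
    have "S \<subseteq> {..<m}" using F that(1) by blast
    then show ?thesis using that(2) by auto
  qed
  have low: "sep (F \<union> H) i j = sep F i j" if "i < m" "j < m" for i j
    using that lift_low by (auto simp: sep_def H_def)
  have high: "sep (F \<union> H) i j = lift ` sep block (i - m) (j - m)" if "m \<le> i" "m \<le> j" for i j
    using that out by (auto simp: sep_def H_def lift_high)
  \<comment> \<open>A set with a new row contains every old row. So for an old and a new row one
    direction is empty, and the other may be arbitrarily large.\<close>
  have none: "sep (F \<union> H) j i = {}" if "i < m" "m \<le> j" for i j
    using that out by (auto simp: sep_def H_def lift_low)
  have "family (m + 5) (F \<union> H)"
    unfolding family_def
  proof (intro conjI allI impI)
    have "Pow {..<m} \<subseteq> Pow {..<m + 5}" by auto
    then show "F \<union> H \<subseteq> Pow {..<m + 5}" using F H by blast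
    fix i j assume ij: "i < m + 5" "j < m + 5" "sep (F \<union> H) j i \<noteq> {}"
    consider "i < m" "j < m" | "m \<le> i" "m \<le> j" | "i < m" "m \<le> j" | "j < m" "m \<le> i" by linarith
    then show "card (sep (F \<union> H) i j) \<le> 7"
    proof cases
      case 1
      then show ?thesis using fam ij by (simp add: low family_def)
    next
      case 2
      then have "i - m < 5" "j - m < 5" "sep block (j - m) (i - m) \<noteq> {}" using ij by (auto simp: high)
      then have "card (sep block (i - m) (j - m)) \<le> 7" using family_block by (simp add: family_def)
      then show ?thesis
        using 2 card_image_le[OF finite_sep[OF blk(2)], of lift "i - m" "j - m"] by (simp add: high)
    qed (use none ij in auto)
  qed
  moreover have "{..<m + 5} \<in> F \<union> H"
  proof -
    have "{..<5} \<in> block"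
    proof -
      have ne: "A \<noteq> B" if "x \<in> A" "x \<notin> B" for x :: nat and A B using that by blast
      have "{..<5::nat} \<noteq> {0, 1, 2}" "{..<5::nat} \<noteq> {0, 3, 4}"
        "{..<5::nat} \<noteq> {1, 3}" "{..<5::nat} \<noteq> {2, 4}"
        by (rule ne[of 3], simp, simp) (rule ne[of 1], simp, simp, (rule ne[of 0], simp, simp)+)
      then show ?thesis by (simp add: block_def)
    qed
    then have "lift {..<5} \<in> H" by (simp add: H_def)
    then show ?thesis by (simp add: lift_top)
  qed
  ultimately show ?thesis using card that by blast
qed

text \<open>The start on zero rows is the family of the empty set alone, which is also the full set
  there; it accounts for the summand 1.\<close>

lemma family_5_mult:
  "\<exists>F. family (5 * k) F \<and> card F = 27 * k + 1 \<and> {..<5 * k} \<in> F"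
proof (induction k)
  case 0
  have "family (5 * 0) {{}}" by (simp add: family_def)
  then show ?case by (intro exI[of _ "{{}}"]) simp
next
  case (Suc k)
  then obtain F where F: "family (5 * k) F" "card F = 27 * k + 1" "{..<5 * k} \<in> F" by blast
  obtain G where "family (5 * k + 5) G" "card G = card F + 27" "{..<5 * k + 5} \<in> G"
    using family_extend[OF F(1,3)] .
  then show ?case using F(2) by (intro exI[of _ G]) (simp add: add.commute)
qed

theorem theorem3:
  fixes m :: nat
  assumes "m \<ge> 1"
  shows "int (forb m (F_0p10 8)) \<le> \<lfloor>27 / 5 * real m\<rfloor> + 1 \<and>
         ([m = 0] (mod 5) \<longrightarrow> int (forb m (F_0p10 8)) = \<lfloor>27 / 5 * real m\<rfloor> + 1)"
proof -
  have "\<lfloor>27 / 5 * real m\<rfloor> = \<lfloor>real (27 * m) / real 5\<rfloor>" by simp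
  also have "\<dots> = int (27 * m div 5)" by (rule floor_divide_of_nat_eq)
  finally have floor: "\<lfloor>27 / 5 * real m\<rfloor> = int (27 * m div 5)" .
  have "forb m (F_0p10 8) \<in> dim_col ` Avoid m (F_0p10 8)"
    unfolding forb_def
    by (intro Max_in finite_Avoid_dims) (simp add: Avoid_nonempty F_0p10_entries)
  then obtain A where A: "A \<in> Avoid m (F_0p10 8)" "forb m (F_0p10 8) = dim_col A" by auto
  obtain F where "family m F" "card F = dim_col A" using Avoid_imp_family[OF A(1)] .
  then have "5 * forb m (F_0p10 8) \<le> 27 * m + 5" using card_family_le A(2) by metis
  \<comment> \<open>As \<open>forb\<close> is an integer, division by 5 may round down, and the
    summand 5 becomes 1.\<close>
  then have upper: "forb m (F_0p10 8) \<le> 27 * m div 5 + 1" by linarith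
  have lower: "27 * m div 5 + 1 \<le> forb m (F_0p10 8)" if "[m = 0] (mod 5)"
  proof -
    obtain k where k: "m = 5 * k" using \<open>[m = 0] (mod 5)\<close> by (auto simp: cong_0_iff)
    obtain G where G: "family m G" "card G = 27 * k + 1" using family_5_mult[of k] k by auto
    obtain B where B: "B \<in> Avoid m (F_0p10 8)" "dim_col B = card G" using family_imp_Avoid[OF G(1)] .
    have "dim_col B \<le> forb m (F_0p10 8)"
      unfolding forb_def using B(1) by (intro Max_ge finite_Avoid_dims imageI)
    then show ?thesis using B(2) G(2) k by simp
  qed
  show ?thesis using upper lower floor by fastforce
qed

end
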